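(* Let $\mu>0$ and $L>0$, let $f\in \mathcal{F}_{\mu,L}(\mathbb{R}^n)$, let $\mathbf{x}_*$ be a global minimizer of $f$ on $\mathbb{R}^n$, and let $f_* = f(\mathbf{x}_* )$. Given a relative tolerance $\varepsilon$ with $0\le\varepsilon<1$ and any starting point $\mathbf{x}_0\in\mathbb{R}^n$, any iterates $\mathbf{x}_0,\mathbf{x}_1,\mathbf{x}_2,\ldots$ of the noisy gradient descent method with exact line search applied to $f$ with tolerance $\varepsilon$ satisfy $$f(\mathbf{x}_{i+1}) - f_*\leq \left(\frac{1-\kappa_{\varepsilon}}{1+\kappa_{\varepsilon}}\right)^2 \left(f(\mathbf{x}_i)-f_*\right) \quad \text{for all } i = 0,1,\ldots,$$ where $\kappa_{\varepsilon}= \frac{\mu}{L}\cdot\frac{1-\varepsilon}{1+\varepsilon}$.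
   Context: For $L>0$ and $\mu>0$, $\mathcal{F}_{\mu,L}(\mathbb{R}^n)$ denotes the class of $L$-smooth, $\mu$-strongly convex functions on $\mathbb{R}^n$, i.e. continuously differentiable functions $f:\mathbb{R}^n\to\mathbb{R}$ such that (1) $\mathbf{x}\mapsto f(\mathbf{x})-\frac{\mu}{2}\|\mathbf{x}\|^2$ is convex on $\mathbb{R}^n$, where $\|\cdot\|$ is the Euclidean norm; and (2) $\|\nabla f(\mathbf{x}+\Delta\mathbf{x})-\nabla f(\mathbf{x})\|\le L\|\Delta\mathbf{x}\|$ for all $\mathbf{x},\Delta\mathbf{x}\in\mathbb{R}^n$. Noisy gradient descent method with exact line search: given $f\in\mathcal{F}_{\mu,L}(\mathbb{R}^n)$, $\mathbf{x}_0\in\mathbb{R}^n$ and $0\le\varepsilon<1$, for $i=0,1,\ldots$ select any search direction $\mathbf{d}_i\in\mathbb{R}^n$ satisfying $\|-\nabla f(\mathbf{x}_i)-\mathbf{d}_i\|\le\varepsilon\|\nabla f(\mathbf{x}_i)\|$, choose $\gamma\in\operatorname{argmin}_{\gamma\in\mathbb{R}} f(\mathbf{x}_i-\gamma\mathbf{d}_i)$, and set $\mathbf{x}_{i+1}=\mathbf{x}_i-\gamma\mathbf{d}_i$. *)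

theory Defs
  imports "HOL-Analysis.Analysis"
begin

text \<open>Meaningful only where \<open>f\<close> is differentiable; elsewhere the value is unspecified.\<close>
definition gradient :: "('a::real_inner \<Rightarrow> real) \<Rightarrow> 'a \<Rightarrow> 'a" where
  "gradient f x = (THE D. GDERIV f x :> D)"

lemma gradient_eqI:
  assumes "GDERIV f x :> D"
  shows "gradient f x = D"
proof -
  have "E = D" if "GDERIV f x :> E" for E
  proof -
    have "(\<lambda>h. h \<bullet> E) = (\<lambda>h. h \<bullet> D)"
      using that assms unfolding gderiv_def by (rule has_derivative_unique)
    then show ?thesis by (metis vector_eq_ldot)
  qed
  with assms show ?thesis unfolding gradient_def by blast
qed

definition smooth_strongly_convex :: "real \<Rightarrow> real \<Rightarrow> (real ^ 'n \<Rightarrow> real) set" where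
  "smooth_strongly_convex \<mu> L = {f.
     (\<forall>x. f differentiable (at x)) \<and> continuous_on UNIV (gradient f) \<and>
     convex_on UNIV (\<lambda>x. f x - \<mu> / 2 * (norm x)\<^sup>2) \<and>
     (\<forall>x \<Delta>x. norm (gradient f (x + \<Delta>x) - gradient f x) \<le> L * norm \<Delta>x)}"

text \<open>The sequence \<open>x\<close> is one possible run of the method: each step may use any direction
  within the tolerance and any minimising step length, which may be negative.\<close>
definition noisy_gradient_descent ::
  "(real ^ 'n \<Rightarrow> real) \<Rightarrow> real \<Rightarrow> real ^ 'n \<Rightarrow> (nat \<Rightarrow> real ^ 'n) \<Rightarrow> bool" where
  "noisy_gradient_descent f \<epsilon> x0 x \<longleftrightarrow>
     x 0 = x0 \<and>
     (\<forall>i. \<exists>d \<gamma>.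
        norm (- gradient f (x i) - d) \<le> \<epsilon> * norm (gradient f (x i)) \<and>
        is_arg_min (\<lambda>\<gamma>. f (x i - \<gamma> *\<^sub>R d)) (\<lambda>_. True) \<gamma> \<and>
        x (Suc i) = x i - \<gamma> *\<^sub>R d)"

end

theory Submission
  imports Defs
begin

text \<open>
  The noisy step reduces to a noise-free one by a linear change of variables. Since
  \<open>- d = g + e\<close> with \<open>g\<close> the gradient and \<open>norm e \<le> \<epsilon> * norm g\<close>, a reflection \<open>R\<close> sends \<open>g\<close> to a
  multiple of \<open>e\<close>, so that \<open>- d = P g\<close> for the symmetric operator \<open>P = I + \<delta> R\<close>, where
  \<open>\<delta> \<le> \<epsilon>\<close>. With \<open>A\<close> the square root of \<open>P\<close>, exact line search along \<open>d\<close> for \<open>f\<close> is exact line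
  search along the gradient for \<open>f \<circ> A\<close>, whose curvature lies between \<open>(1 - \<epsilon>) \<mu>\<close> and
  \<open>(1 + \<epsilon>) L\<close>. The noise-free step is a weighted sum of three interpolation inequalities, whose
  remainder is a sum of two squares (the certificate of de Klerk, Glineur and Taylor).
\<close>

section \<open>Interpolation inequality and the noise-free step\<close>

text \<open>\<open>g\<close> is any vector field, not necessarily a gradient: the bounds then carry
  over to \<open>f\<close> composed with a linear map without differentiating again.\<close>

definition quadratic_bounds ::
  "('a::real_inner \<Rightarrow> real) \<Rightarrow> ('a \<Rightarrow> 'a) \<Rightarrow> real \<Rightarrow> real \<Rightarrow> bool" where
  "quadratic_bounds f g \<mu> L \<longleftrightarrow>
     (\<forall>x y. f x + g x \<bullet> (y - x) + \<mu> / 2 * (norm (y - x))\<^sup>2 \<le> f y \<and>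
            f y \<le> f x + g x \<bullet> (y - x) + L / 2 * (norm (y - x))\<^sup>2)"

text \<open>At any point \<open>y - t\<close> the lower bound around \<open>x\<close> lies below the
  upper bound around \<open>y\<close>. The best \<open>t\<close> gives the interpolation inequality
  of the class, multiplied by \<open>2 * (L - \<mu>)\<close>.\<close>

lemma quadratic_bounds_interpolation:
  fixes f :: "'a::real_inner \<Rightarrow> real"
  assumes qb: "quadratic_bounds f g \<mu> L" and "\<mu> < L"
  shows "L * \<mu> * (norm (y - x))\<^sup>2 - 2 * \<mu> * ((g y - g x) \<bullet> (y - x)) + (norm (g y - g x))\<^sup>2
    \<le> 2 * (L - \<mu>) * (f y - f x - g x \<bullet> (y - x))"
proof -
  define w where "w = y - x"
  define h where "h = g y - g x"
  obtain c where c: "(L - \<mu>) * c = 1"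
    using \<open>\<mu> < L\<close> that[of "1 / (L - \<mu>)"] by simp
  \<comment> \<open>\<open>y - t\<close> is the point where the lower bound from \<open>x\<close> exceeds the upper bound from \<open>y\<close> the most.\<close>
  define t where "t = c *\<^sub>R (h - \<mu> *\<^sub>R w)"
  have "f x + g x \<bullet> (w - t) + \<mu> / 2 * (norm (w - t))\<^sup>2 \<le> f (y - t)"
    using qb[unfolded quadratic_bounds_def, rule_format, of x "y - t"]
    by (simp add: w_def algebra_simps)
  also have "f (y - t) \<le> f y - g y \<bullet> t + L / 2 * (norm t)\<^sup>2"
    using qb[unfolded quadratic_bounds_def, rule_format, of y "y - t"] by simp
  finally have "f x + g x \<bullet> w + h \<bullet> t - L / 2 * (t \<bullet> t) + \<mu> / 2 * ((w - t) \<bullet> (w - t)) \<le> f y"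
    by (simp add: h_def power2_norm_eq_inner inner_diff_left inner_diff_right)
  moreover have "h \<bullet> t - L / 2 * (t \<bullet> t) + \<mu> / 2 * ((w - t) \<bullet> (w - t))
      = \<mu> / 2 * (w \<bullet> w) + (h - \<mu> *\<^sub>R w) \<bullet> t - (L - \<mu>) / 2 * (t \<bullet> t)"
    by (simp add: inner_diff_left inner_diff_right inner_commute field_simps)
  moreover have "(h - \<mu> *\<^sub>R w) \<bullet> t - (L - \<mu>) / 2 * (t \<bullet> t)
      = c / 2 * ((h - \<mu> *\<^sub>R w) \<bullet> (h - \<mu> *\<^sub>R w))"
    using c by (simp add: t_def)
  ultimately have "\<mu> / 2 * (w \<bullet> w) + c / 2 * ((h - \<mu> *\<^sub>R w) \<bullet> (h - \<mu> *\<^sub>R w)) \<le> f y - f x - g x \<bullet> w"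
    by linarith
  then have "2 * (L - \<mu>) * (\<mu> / 2 * (w \<bullet> w) + c / 2 * ((h - \<mu> *\<^sub>R w) \<bullet> (h - \<mu> *\<^sub>R w)))
      \<le> 2 * (L - \<mu>) * (f y - f x - g x \<bullet> w)"
    using \<open>\<mu> < L\<close> by (intro mult_left_mono) auto
  moreover have "2 * (L - \<mu>) * (\<mu> / 2 * (w \<bullet> w) + c / 2 * ((h - \<mu> *\<^sub>R w) \<bullet> (h - \<mu> *\<^sub>R w)))
      = L * \<mu> * (w \<bullet> w) - 2 * \<mu> * (h \<bullet> w) + h \<bullet> h"
    using c unfolding inner_diff_left inner_diff_right inner_scaleR_left inner_scaleR_right
      inner_commute[of w h]
    by algebra
  ultimately show ?thesis
    by (simp add: w_def h_def power2_norm_eq_inner)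
qed

text \<open>This is the weighted sum of the left sides of three interpolation inequalities;
  \<open>u\<close>, \<open>v\<close> stand for the offsets of two iterates from the minimiser and
  \<open>p\<close>, \<open>q\<close> for the gradients there.\<close>

lemma line_search_remainder_nonneg:
  fixes u v p q :: "'a::real_inner"
  assumes "0 < \<mu>" and "\<mu> < L" and uv: "q \<bullet> v = q \<bullet> u" and pq: "p \<bullet> q = 0"
  shows "0 \<le> (L - \<mu>) * (L + \<mu>) *
        (L * \<mu> * ((u - v) \<bullet> (u - v)) - 2 * \<mu> * ((p - q) \<bullet> (u - v)) + (p - q) \<bullet> (p - q))
      + 2 * \<mu> * (L - \<mu>) * (L * \<mu> * (u \<bullet> u) - 2 * L * (p \<bullet> u) + p \<bullet> p)
      + 2 * \<mu> * (L + \<mu>) * (L * \<mu> * (v \<bullet> v) - 2 * L * (q \<bullet> v) + q \<bullet> q)" (is "0 \<le> ?Q")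
proof -
  \<comment> \<open>The factor \<open>L * (L + 3 * \<mu>)\<close> avoids fractions when completing
    the square in \<open>u\<close>, which gives \<open>s1\<close>. Modulo \<open>uv\<close> and
    \<open>pq\<close> the rest is the square of \<open>s2\<close>, where \<open>u\<close> no longer
    occurs.\<close>
  define s1 where "s1 = (L * (L + 3 * \<mu>)) *\<^sub>R u - (L * (L + \<mu>)) *\<^sub>R v
    - (3 * L + \<mu>) *\<^sub>R p - (L + \<mu>) *\<^sub>R q"
  define s2 where "s2 = (2 * \<mu> * L * (L + \<mu>)) *\<^sub>R v - (L - \<mu>)\<^sup>2 *\<^sub>R p - (L + \<mu>)\<^sup>2 *\<^sub>R q"
  have comm: "v \<bullet> u = u \<bullet> v" "u \<bullet> p = p \<bullet> u" "u \<bullet> q = q \<bullet> u" "v \<bullet> p = p \<bullet> v" "v \<bullet> q = q \<bullet> v"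
      "q \<bullet> p = p \<bullet> q"
    by (simp_all add: inner_commute)
  have "(L * (L + 3 * \<mu>)) * ?Q = \<mu> * (L - \<mu>) * (s1 \<bullet> s1) + s2 \<bullet> s2"
    unfolding s1_def s2_def inner_diff_left inner_diff_right inner_scaleR_left inner_scaleR_right
      comm uv pq
    by algebra
  also have "\<dots> \<ge> 0" using assms by simp
  finally have "0 \<le> (L * (L + 3 * \<mu>)) * ?Q" .
  moreover have "0 < L * (L + 3 * \<mu>)" using assms by simp
  ultimately show ?thesis by (metis zero_le_mult_iff order.asym order.strict_iff_not)
qed

lemma exact_line_search_step:
  fixes f :: "'a::real_inner \<Rightarrow> real"
  assumes qb: "quadratic_bounds f g \<mu> L" and "0 < \<mu>" and "\<mu> < L"
    and min: "g xmin = 0"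
    and step: "g x1 \<bullet> (x1 - x0) = 0" and orth: "g x0 \<bullet> g x1 = 0"
  shows "f x1 - f xmin \<le> ((L - \<mu>) / (L + \<mu>))\<^sup>2 * (f x0 - f xmin)"
proof -
  define u v p q where defs: "u = x0 - xmin" "v = x1 - xmin" "p = g x0" "q = g x1"
  note interp = quadratic_bounds_interpolation[OF qb \<open>\<mu> < L\<close>, unfolded power2_norm_eq_inner]
  have qvu: "q \<bullet> v = q \<bullet> u" using step by (simp add: defs inner_diff_right)
  have uv: "x0 - x1 = u - v" by (simp add: defs)
  have xu: "xmin - x0 = - u" "xmin - x1 = - v" by (simp_all add: defs)
  have I1: "L * \<mu> * ((u - v) \<bullet> (u - v)) - 2 * \<mu> * ((p - q) \<bullet> (u - v)) + (p - q) \<bullet> (p - q)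
      \<le> 2 * (L - \<mu>) * (f x0 - f x1)" (is "?i1 \<le> _")
    using interp[of x0 x1] qvu unfolding uv defs(3,4)[symmetric] by (simp add: inner_diff_right)
  \<comment> \<open>The linear term \<open>2 * (L - \<mu>) * (p \<bullet> u)\<close> moves to the
    left and merges with \<open>- 2 * \<mu> * (p \<bullet> u)\<close>; likewise for \<open>q\<close>
    and \<open>v\<close> in \<open>I3\<close>.\<close>
  have I2: "L * \<mu> * (u \<bullet> u) - 2 * L * (p \<bullet> u) + p \<bullet> p \<le> 2 * (L - \<mu>) * (f xmin - f x0)" (is "?i2 \<le> _")
    using interp[of xmin x0] unfolding xu min defs(3,4)[symmetric] by (simp add: algebra_simps)
  have I3: "L * \<mu> * (v \<bullet> v) - 2 * L * (q \<bullet> v) + q \<bullet> q \<le> 2 * (L - \<mu>) * (f xmin - f x1)" (is "?i3 \<le> _")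
    using interp[of xmin x1] unfolding xu min defs(3,4)[symmetric] by (simp add: algebra_simps)
  \<comment> \<open>The weights are chosen for the right sides: \<open>f x0\<close> receives
    \<open>2 * (L - \<mu>)\<close> times \<open>(L - \<mu>)\<^sup>2\<close>, and \<open>f x1\<close>
    receives \<open>- 2 * (L - \<mu>)\<close> times \<open>(L + \<mu>)\<^sup>2\<close>.\<close>
  have "0 \<le> (L - \<mu>) * (L + \<mu>) * ?i1 + 2 * \<mu> * (L - \<mu>) * ?i2 + 2 * \<mu> * (L + \<mu>) * ?i3"
    using line_search_remainder_nonneg[OF \<open>0 < \<mu>\<close> \<open>\<mu> < L\<close> qvu] orth by (simp add: defs)
  also have "\<dots> \<le> (L - \<mu>) * (L + \<mu>) * (2 * (L - \<mu>) * (f x0 - f x1))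
      + 2 * \<mu> * (L - \<mu>) * (2 * (L - \<mu>) * (f xmin - f x0))
      + 2 * \<mu> * (L + \<mu>) * (2 * (L - \<mu>) * (f xmin - f x1))"
    using \<open>0 < \<mu>\<close> \<open>\<mu> < L\<close> by (intro add_mono mult_left_mono I1 I2 I3) auto
  also have "\<dots> = 2 * (L - \<mu>) * ((L - \<mu>)\<^sup>2 * (f x0 - f xmin) - (L + \<mu>)\<^sup>2 * (f x1 - f xmin))"
    by algebra
  finally have "(L + \<mu>)\<^sup>2 * (f x1 - f xmin) \<le> (L - \<mu>)\<^sup>2 * (f x0 - f xmin)"
    using \<open>\<mu> < L\<close> by (simp add: zero_le_mult_iff)
  then show ?thesis
    using \<open>0 < \<mu>\<close> \<open>\<mu> < L\<close> by (simp add: power_divide field_simps)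
qed

section \<open>Change of variables absorbing the noise\<close>

text \<open>Householder reflection along \<open>w = s - r\<close>: equal norms give
  \<open>2 * (s \<bullet> w) = w \<bullet> w\<close>, so \<open>s\<close> goes to
  \<open>s - w\<close>. For \<open>r = s\<close> it is the identity.\<close>

lemma reflection_exists:
  fixes r s :: "'a::real_inner"
  assumes "norm r = norm s"
  obtains R where "linear R" "\<And>y z. R y \<bullet> z = y \<bullet> R z" "\<And>z. R (R z) = z" "R s = r"
proof -
  define w where "w = s - r"
  define R where "R = (\<lambda>z. z - (2 * (z \<bullet> w) / (w \<bullet> w)) *\<^sub>R w)"
  have "linear R"
    by (rule linearI)
      (simp_all add: R_def inner_add_left add_divide_distrib distrib_left scaleR_add_left algebra_simps)
  moreover have "R y \<bullet> z = y \<bullet> R z" for y z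
    by (simp add: R_def inner_diff_left inner_diff_right inner_commute)
  moreover have "R (R z) = z" for z
  proof (cases "w = 0")
    case False
    then have "R z \<bullet> w = - (z \<bullet> w)" by (simp add: R_def inner_diff_left)
    then have "R (R z) = R z + (2 * (z \<bullet> w) / (w \<bullet> w)) *\<^sub>R w"
      unfolding R_def[THEN fun_cong, of "R z"] by simp
    then show ?thesis by (simp add: R_def)
  qed (simp add: R_def)
  moreover have "R s = r"
  proof (cases "w = 0")
    case False
    have "2 * (s \<bullet> w) = w \<bullet> w"
      using assms by (simp add: w_def norm_eq inner_diff_left inner_diff_right inner_commute)
    with False show ?thesis by (simp add: R_def w_def)
  qed (simp add: R_def w_def)
  ultimately show ?thesis by (rule that)
qed

text \<open>Since a reflection \<open>R\<close> is an involution, combinations of \<open>I\<close>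
  and \<open>R\<close> are closed under composition, so a root of \<open>I + \<delta> R\<close> can
  be sought among them. As \<open>R\<close> is an isometry, \<open>\<delta> \<le> \<epsilon>\<close>
  yields the norm bounds.\<close>

lemma near_identity_square_root:
  fixes g e :: "'a::real_inner"
  assumes "norm e \<le> \<epsilon> * norm g" and "0 \<le> \<epsilon>" and "\<epsilon> < 1"
  obtains A where "linear A" "\<And>y z. A y \<bullet> z = y \<bullet> A z" "surj A" "A (A g) = g + e"
    "\<And>z. (1 - \<epsilon>) * (norm z)\<^sup>2 \<le> (norm (A z))\<^sup>2" "\<And>z. (norm (A z))\<^sup>2 \<le> (1 + \<epsilon>) * (norm z)\<^sup>2"
proof -
  \<comment> \<open>If \<open>g = 0\<close> then \<open>e = 0\<close> too, and division by zero
    gives \<open>\<delta> = 0\<close>.\<close>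
  define \<delta> where "\<delta> = norm e / norm g"
  have \<delta>: "0 \<le> \<delta>" "\<delta> \<le> \<epsilon>" "\<delta> < 1"
    using assms by (auto simp: \<delta>_def divide_le_eq intro: order.strict_trans1)
  obtain R where R: "linear R" "\<And>y z. R y \<bullet> z = y \<bullet> R z" "\<And>z. R (R z) = z" and Rg: "\<delta> *\<^sub>R R g = e"
  proof (cases "e = 0")
    case True
    then show ?thesis by (intro that[of "\<lambda>z. z"]) (auto simp: \<delta>_def linear_iff)
  next
    case False
    with assms have "g \<noteq> 0" by auto
    then have "\<delta> > 0" "norm (inverse \<delta> *\<^sub>R e) = norm g" using False by (auto simp: \<delta>_def)
    then obtain R where "linear R" "\<And>y z. R y \<bullet> z = y \<bullet> R z" "\<And>z. R (R z) = z"
        and "R g = inverse \<delta> *\<^sub>R e"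
      using reflection_exists by blast
    moreover from this have "\<delta> *\<^sub>R R g = e" using \<open>\<delta> > 0\<close> by simp
    ultimately show ?thesis by (intro that[of R]) auto
  qed
  \<comment> \<open>\<open>A\<close> acts as \<open>a + b = sqrt (1 + \<delta>)\<close> and
    \<open>a - b = sqrt (1 - \<delta>)\<close> on the eigenspaces of \<open>R\<close> for
    \<open>1\<close> and \<open>-1\<close>.\<close>
  define a b where ab: "a = (sqrt (1 + \<delta>) + sqrt (1 - \<delta>)) / 2" "b = (sqrt (1 + \<delta>) - sqrt (1 - \<delta>)) / 2"
  have sq: "sqrt (1 + \<delta>) ^ 2 = 1 + \<delta>" "sqrt (1 - \<delta>) ^ 2 = 1 - \<delta>" using \<delta> by auto
  have ab1: "a * a + b * b = 1" and ab2: "2 * (a * b) = \<delta>"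
    using sq by (simp_all add: ab power2_eq_square field_simps)
  have ab3: "a * a - b * b > 0"
  proof -
    have "a * a - b * b = sqrt (1 + \<delta>) * sqrt (1 - \<delta>)" by (simp add: ab field_simps)
    then show ?thesis using \<delta> by simp
  qed
  define A where "A = (\<lambda>z. a *\<^sub>R z + b *\<^sub>R R z)"
  \<comment> \<open>The inverse comes from
    \<open>(a I + b R) (a I - b R) = (a * a - b * b) I\<close>.\<close>
  define B where "B = (\<lambda>z. inverse (a * a - b * b) *\<^sub>R (a *\<^sub>R z - b *\<^sub>R R z))"
  interpret R: linear R by (rule R)
  have linA: "linear A"
    by (rule linearI) (simp_all add: A_def R.add R.scaleR algebra_simps)
  have symA: "A y \<bullet> z = y \<bullet> A z" for y z
    by (simp add: A_def inner_add_left inner_add_right R)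
  have AA: "A (A z) = z + \<delta> *\<^sub>R R z" for z
  proof -
    have "A (A z) = (a * a + b * b) *\<^sub>R z + (2 * (a * b)) *\<^sub>R R z"
      by (simp add: A_def R.add R.scaleR R(3) algebra_simps flip: scaleR_2)
    then show ?thesis by (simp add: ab1 ab2)
  qed
  have AB: "A (B z) = z" for z
  proof -
    have "A (B z) = inverse (a * a - b * b) *\<^sub>R ((a * a - b * b) *\<^sub>R z)"
      by (simp add: A_def B_def R.diff R.scaleR R(3) algebra_simps)
    then show ?thesis using ab3 by simp
  qed
  have normA: "(norm (A z))\<^sup>2 = (norm z)\<^sup>2 + \<delta> * (z \<bullet> R z)" for z
    by (simp add: power2_norm_eq_inner symA AA inner_add_right)
  have "norm (R z) = norm z" for z by (simp add: norm_eq R)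
  then have zRz: "\<bar>\<delta> * (z \<bullet> R z)\<bar> \<le> \<epsilon> * (norm z)\<^sup>2" for z
    using \<delta> Cauchy_Schwarz_ineq2[of z "R z"]
    by (simp add: abs_mult power2_eq_square mult_mono)
  show ?thesis
  proof (rule that[OF linA symA])
    show "surj A" using AB by (metis surjI)
    show "A (A g) = g + e" by (simp add: AA Rg)
    show "(1 - \<epsilon>) * (norm z)\<^sup>2 \<le> (norm (A z))\<^sup>2" "(norm (A z))\<^sup>2 \<le> (1 + \<epsilon>) * (norm z)\<^sup>2" for z
      using zRz[of z] by (auto simp: normA algebra_simps)
  qed
qed

text \<open>For self-adjoint \<open>A\<close>, the transformed field is the one the chain rule
  gives. Since \<open>m\<close> and \<open>M\<close> bound squared norms, they multiply the
  curvature constants directly.\<close>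

lemma quadratic_bounds_compose:
  fixes f :: "'a::real_inner \<Rightarrow> real"
  assumes qb: "quadratic_bounds f g \<mu> L" and "0 \<le> \<mu>" and "0 \<le> L"
    and A: "linear A" "\<And>y z. A y \<bullet> z = y \<bullet> A z"
    and lo: "\<And>z. m * (norm z)\<^sup>2 \<le> (norm (A z))\<^sup>2" and hi: "\<And>z. (norm (A z))\<^sup>2 \<le> M * (norm z)\<^sup>2"
  shows "quadratic_bounds (\<lambda>z. f (A z)) (\<lambda>z. A (g (A z))) (m * \<mu>) (M * L)"
  unfolding quadratic_bounds_def
proof (intro allI)
  fix x y
  have diff: "A y - A x = A (y - x)" by (simp add: linear_diff[OF A(1)])
  have "m * \<mu> / 2 * (norm (y - x))\<^sup>2 \<le> \<mu> / 2 * (norm (A (y - x)))\<^sup>2"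
    using mult_left_mono[OF lo[of "y - x"], of "\<mu> / 2"] \<open>0 \<le> \<mu>\<close> by (simp add: mult_ac)
  moreover have "L / 2 * (norm (A (y - x)))\<^sup>2 \<le> M * L / 2 * (norm (y - x))\<^sup>2"
    using mult_left_mono[OF hi[of "y - x"], of "L / 2"] \<open>0 \<le> L\<close> by (simp add: mult_ac)
  ultimately show "f (A x) + A (g (A x)) \<bullet> (y - x) + m * \<mu> / 2 * (norm (y - x))\<^sup>2 \<le> f (A y) \<and>
      f (A y) \<le> f (A x) + A (g (A x)) \<bullet> (y - x) + M * L / 2 * (norm (y - x))\<^sup>2"
    using qb[unfolded quadratic_bounds_def, rule_format, of "A x" "A y"] unfolding diff A(2) by linarith
qed

lemma noisy_line_search_step:
  fixes f :: "'a::real_inner \<Rightarrow> real"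
  assumes qb: "quadratic_bounds f g \<mu> L" and "0 < \<mu>" and "\<mu> < L" and "0 \<le> \<epsilon>" and "\<epsilon> < 1"
    and min: "g xmin = 0"
    and noise: "norm (- g x0 - d) \<le> \<epsilon> * norm (g x0)"
    and step: "g x1 \<bullet> (x1 - x0) = 0" and orth: "g x1 \<bullet> d = 0"
  shows "f x1 - f xmin
    \<le> (((1 + \<epsilon>) * L - (1 - \<epsilon>) * \<mu>) / ((1 + \<epsilon>) * L + (1 - \<epsilon>) * \<mu>))\<^sup>2 * (f x0 - f xmin)"
proof -
  obtain A where A: "linear A" "\<And>y z. A y \<bullet> z = y \<bullet> A z" "surj A" "A (A (g x0)) = g x0 + (- g x0 - d)"
    "\<And>z. (1 - \<epsilon>) * (norm z)\<^sup>2 \<le> (norm (A z))\<^sup>2" "\<And>z. (norm (A z))\<^sup>2 \<le> (1 + \<epsilon>) * (norm z)\<^sup>2"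
    using near_identity_square_root[OF noise \<open>0 \<le> \<epsilon>\<close> \<open>\<epsilon> < 1\<close>] by metis
  obtain z0 z1 zmin where z: "x0 = A z0" "x1 = A z1" "xmin = A zmin"
    using \<open>surj A\<close> by (meson surjD)
  have "f (A z1) - f (A zmin)
    \<le> (((1 + \<epsilon>) * L - (1 - \<epsilon>) * \<mu>) / ((1 + \<epsilon>) * L + (1 - \<epsilon>) * \<mu>))\<^sup>2 * (f (A z0) - f (A zmin))"
  proof (rule exact_line_search_step[of "\<lambda>z. f (A z)" "\<lambda>z. A (g (A z))"])
    show "quadratic_bounds (\<lambda>z. f (A z)) (\<lambda>z. A (g (A z))) ((1 - \<epsilon>) * \<mu>) ((1 + \<epsilon>) * L)"
      using assms A by (intro quadratic_bounds_compose) auto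
    show "0 < (1 - \<epsilon>) * \<mu>" using assms by simp
    have "(1 - \<epsilon>) * \<mu> \<le> 1 * \<mu>" "1 * L \<le> (1 + \<epsilon>) * L"
      using assms by (auto intro!: mult_right_mono)
    then show "(1 - \<epsilon>) * \<mu> < (1 + \<epsilon>) * L" using \<open>\<mu> < L\<close> by simp
    show "A (g (A zmin)) = 0" using min z linear_0[OF A(1)] by simp
    show "A (g (A z1)) \<bullet> (z1 - z0) = 0" using step z by (simp add: A(2) linear_diff[OF A(1)])
    \<comment> \<open>Here \<open>A (A (g x0)) = - d\<close>, so orthogonality of
      \<open>g x1\<close> to the noisy direction becomes orthogonality of the two transformed
      gradients.\<close>
    have "A (g x0) \<bullet> A (g x1) = g x1 \<bullet> A (A (g x0))"
      by (subst inner_commute) (rule A(2))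
    then show "A (g (A z0)) \<bullet> A (g (A z1)) = 0" using A(4) orth z by (simp add: inner_minus_right)
  qed
  then show ?thesis by (simp add: z)
qed

section \<open>From smoothness and strong convexity to quadratic bounds\<close>

lemma GDERIV_along_line:
  fixes f :: "'a::real_inner \<Rightarrow> real"
  assumes "GDERIV f (x + t *\<^sub>R w) :> D"
  shows "((\<lambda>t. f (x + t *\<^sub>R w)) has_real_derivative D \<bullet> w) (at t)"
proof -
  have "((\<lambda>t. x + t *\<^sub>R w) has_derivative (\<lambda>h. h *\<^sub>R w)) (at t)"
    by (auto intro!: derivative_eq_intros)
  then have "((\<lambda>t. f (x + t *\<^sub>R w)) has_derivative (\<lambda>h. (h *\<^sub>R w) \<bullet> D)) (at t)"
    by (rule has_derivative_compose) (use assms in \<open>simp add: gderiv_def\<close>)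
  moreover have "(\<lambda>h. (h *\<^sub>R w) \<bullet> D) = (*) (D \<bullet> w)"
    by (auto simp: inner_commute)
  ultimately show ?thesis
    by (simp add: has_field_derivative_def)
qed

lemma GDERIV_gradient:
  fixes f :: "'a::euclidean_space \<Rightarrow> real"
  assumes "f differentiable (at x)"
  shows "GDERIV f x :> gradient f x"
proof -
  obtain F where F: "(f has_derivative F) (at x)" using assms by (auto simp: differentiable_def)
  then have "linear F" by (rule has_derivative_linear)
  \<comment> \<open>Riesz representation of the derivative, with the vector obtained from the
    adjoint.\<close>
  then have "F = (\<lambda>h. h \<bullet> adjoint F 1)"
    using adjoint_works[of F _ 1] by (auto simp: inner_real_def)
  with F have "GDERIV f x :> adjoint F 1" by (simp add: gderiv_def)
  then show ?thesis using gradient_eqI by metis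
qed

text \<open>Both bounds are proved on the line through \<open>x\<close> and \<open>y\<close>: the
  lower one is a tangent inequality for a convex function, the upper one a monotonicity argument
  from the Lipschitz gradient.\<close>

lemma smooth_strongly_convex_quadratic_bounds:
  fixes f :: "real ^ 'n \<Rightarrow> real"
  assumes f: "f \<in> smooth_strongly_convex \<mu> L"
  shows "quadratic_bounds f (gradient f) \<mu> L"
  unfolding quadratic_bounds_def
proof (intro allI conjI)
  fix x y :: "real ^ 'n"
  let ?g = "gradient f"
  define w where "w = y - x"
  have "f differentiable (at z)" for z using f by (simp add: smooth_strongly_convex_def)
  then have D: "((\<lambda>t. f (x + t *\<^sub>R w)) has_real_derivative ?g (x + t *\<^sub>R w) \<bullet> w) (at t)" for t
    by (intro GDERIV_along_line GDERIV_gradient)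
  have y: "x + w = y" by (simp add: w_def)

  define \<phi> where "\<phi> = (\<lambda>t. f (x + t *\<^sub>R w) - \<mu> / 2 * (norm (x + t *\<^sub>R w))\<^sup>2)"
  have sq: "(norm (x + t *\<^sub>R w))\<^sup>2 = x \<bullet> x + 2 * t * (x \<bullet> w) + t\<^sup>2 * (w \<bullet> w)" for t
    by (simp add: power2_norm_eq_inner inner_add_left inner_add_right inner_commute[of w x])
      (simp add: power2_eq_square algebra_simps)
  have "convex_on UNIV \<phi>"
  proof (rule convex_onI)
    fix t s1 s2 :: real assume t: "0 < t" "t < 1"
    have "convex_on UNIV (\<lambda>x. f x - \<mu> / 2 * (norm x)\<^sup>2)"
      using f by (simp add: smooth_strongly_convex_def)
    from convex_onD[OF this, of t "x + s1 *\<^sub>R w" "x + s2 *\<^sub>R w"] t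
    show "\<phi> ((1 - t) *\<^sub>R s1 + t *\<^sub>R s2) \<le> (1 - t) * \<phi> s1 + t * \<phi> s2"
      by (simp add: \<phi>_def algebra_simps)
  qed simp
  moreover have "(\<phi> has_real_derivative ?g x \<bullet> w - \<mu> * (x \<bullet> w)) (at 0)"
    unfolding \<phi>_def sq
  proof (rule DERIV_diff)
    show "((\<lambda>t. f (x + t *\<^sub>R w)) has_real_derivative ?g x \<bullet> w) (at 0)" using D[of 0] by simp
  qed (auto intro!: derivative_eq_intros)
  \<comment> \<open>In this tangent inequality the terms \<open>\<mu> * (x \<bullet> w)\<close>
    cancel, leaving \<open>\<mu> / 2 * (w \<bullet> w)\<close>.\<close>
  ultimately have "\<phi> 1 - \<phi> 0 \<ge> (?g x \<bullet> w - \<mu> * (x \<bullet> w)) * (1 - 0)"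
    by (intro convex_on_imp_above_tangent[of UNIV]) auto
  then show "f x + ?g x \<bullet> (y - x) + \<mu> / 2 * (norm (y - x))\<^sup>2 \<le> f y"
    unfolding \<phi>_def sq w_def[symmetric] scaleR_one mult_zero_left
    by (simp add: y power2_norm_eq_inner) (simp add: field_simps)

  \<comment> \<open>Up to a constant, \<open>\<psi>\<close> is \<open>f\<close> minus its upper
    model; along the segment the gradient changes by at most \<open>L * t * norm w\<close>, so its
    derivative is nonpositive.\<close>
  define \<psi> where "\<psi> = (\<lambda>t. f (x + t *\<^sub>R w) - (t * (?g x \<bullet> w) + L / 2 * t\<^sup>2 * (norm w)\<^sup>2))"
  have "\<psi> 1 \<le> \<psi> 0"
  proof (rule DERIV_nonpos_imp_nonincreasing[of 0 1 \<psi>])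
    fix t :: real assume "0 \<le> t" "t \<le> 1"
    have "((\<lambda>t. t * (?g x \<bullet> w) + L / 2 * t\<^sup>2 * (norm w)\<^sup>2)
        has_real_derivative ?g x \<bullet> w + L * t * (norm w)\<^sup>2) (at t)"
      by (rule derivative_eq_intros refl | simp)+
    from DERIV_diff[OF D this]
    have "(\<psi> has_real_derivative (?g (x + t *\<^sub>R w) - ?g x) \<bullet> w - L * t * (norm w)\<^sup>2) (at t)"
      by (simp add: \<psi>_def inner_diff_left algebra_simps)
    moreover have "(?g (x + t *\<^sub>R w) - ?g x) \<bullet> w \<le> norm (?g (x + t *\<^sub>R w) - ?g x) * norm w"
      by (rule norm_cauchy_schwarz)
    moreover have "\<dots> \<le> L * norm (t *\<^sub>R w) * norm w"
      using f unfolding smooth_strongly_convex_def by (blast intro: mult_right_mono norm_ge_zero)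
    ultimately show "\<exists>D. (\<psi> has_real_derivative D) (at t) \<and> D \<le> 0"
      using \<open>0 \<le> t\<close> by (intro exI[of _ "(?g (x + t *\<^sub>R w) - ?g x) \<bullet> w - L * t * (norm w)\<^sup>2"])
        (simp add: power2_eq_square mult_ac)
  qed simp
  then show "f y \<le> f x + ?g x \<bullet> (y - x) + L / 2 * (norm (y - x))\<^sup>2"
    unfolding \<psi>_def by (simp add: y) (simp add: w_def)
qed

lemma quadratic_bounds_mono:
  fixes f :: "'a::real_inner \<Rightarrow> real"
  assumes "quadratic_bounds f g \<mu> L" and "L \<le> L'"
  shows "quadratic_bounds f g \<mu> L'"
  unfolding quadratic_bounds_def
proof (intro allI)
  fix x y :: 'a
  have "L / 2 * (norm (y - x))\<^sup>2 \<le> L' / 2 * (norm (y - x))\<^sup>2"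
    using \<open>L \<le> L'\<close> by (intro mult_right_mono) auto
  then show "f x + g x \<bullet> (y - x) + \<mu> / 2 * (norm (y - x))\<^sup>2 \<le> f y \<and>
      f y \<le> f x + g x \<bullet> (y - x) + L' / 2 * (norm (y - x))\<^sup>2"
    using assms(1)[unfolded quadratic_bounds_def, rule_format, of x y] by linarith
qed

lemma quadratic_bounds_le:
  fixes f :: "'a::euclidean_space \<Rightarrow> real"
  assumes "quadratic_bounds f g \<mu> L"
  shows "\<mu> \<le> L"
proof -
  obtain b :: 'a where "b \<in> Basis" using nonempty_Basis by blast
  then show ?thesis
    using assms[unfolded quadratic_bounds_def, rule_format, of 0 b] by simp
qed

text \<open>Step lengths range over all reals, so the minimiser is interior and the directional
  derivative vanishes.\<close>

lemma line_argmin_imp_orthogonal: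
  fixes f :: "'a::real_inner \<Rightarrow> real"
  assumes "is_arg_min (\<lambda>\<gamma>. f (x - \<gamma> *\<^sub>R d)) (\<lambda>_. True) \<gamma>" and "GDERIV f (x - \<gamma> *\<^sub>R d) :> D"
  shows "D \<bullet> d = 0"
proof -
  have "((\<lambda>t. f (x + t *\<^sub>R (- d))) has_real_derivative D \<bullet> (- d)) (at \<gamma>)"
    by (rule GDERIV_along_line) (use assms in simp)
  then have "D \<bullet> (- d) = 0"
    by (rule DERIV_local_min[of _ _ _ 1]) (use assms in \<open>auto simp: is_arg_min_linorder\<close>)
  then show ?thesis by simp
qed

theorem theorem5p1:
  fixes f :: "real ^ 'n \<Rightarrow> real"
    and \<mu> L \<epsilon> \<kappa> fmin :: real
    and xmin x0 :: "real ^ 'n"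
    and x :: "nat \<Rightarrow> real ^ 'n"
  assumes "\<mu> > 0" and "L > 0"
    and "f \<in> smooth_strongly_convex \<mu> L"
    and "is_arg_min f (\<lambda>_. True) xmin"
    and "fmin = f xmin"
    and "0 \<le> \<epsilon>" and "\<epsilon> < 1"
    and "noisy_gradient_descent f \<epsilon> x0 x"
    and "\<kappa> = \<mu> / L * ((1 - \<epsilon>) / (1 + \<epsilon>))"
  shows "\<forall>i. f (x (Suc i)) - fmin \<le> ((1 - \<kappa>) / (1 + \<kappa>))\<^sup>2 * (f (x i) - fmin)"
proof
  fix i
  let ?g = "gradient f"
  have qb: "quadratic_bounds f ?g \<mu> L"
    using assms(3) by (rule smooth_strongly_convex_quadratic_bounds)
  have "f differentiable (at z)" for z using assms(3) by (simp add: smooth_strongly_convex_def)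
  then have G: "GDERIV f z :> ?g z" for z by (rule GDERIV_gradient)
  obtain d \<gamma> where d: "norm (- ?g (x i) - d) \<le> \<epsilon> * norm (?g (x i))"
    and \<gamma>: "is_arg_min (\<lambda>\<gamma>. f (x i - \<gamma> *\<^sub>R d)) (\<lambda>_. True) \<gamma>" and x: "x (Suc i) = x i - \<gamma> *\<^sub>R d"
    using assms(8) unfolding noisy_gradient_descent_def by blast
  have orth: "?g (x (Suc i)) \<bullet> d = 0"
    using line_argmin_imp_orthogonal[OF \<gamma> G] by (simp add: x)
  have step: "?g (x (Suc i)) \<bullet> (x (Suc i) - x i) = 0" using orth by (simp add: x)
  \<comment> \<open>A global minimiser also minimises along its own gradient direction, with step
    length \<open>0\<close>.\<close>
  have "?g xmin \<bullet> ?g xmin = 0"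
    by (rule line_argmin_imp_orthogonal[of f xmin _ 0])
      (use assms(4) G in \<open>auto simp: is_arg_min_linorder\<close>)
  then have min: "?g xmin = 0" by simp
  let ?\<rho> = "\<lambda>M. (((1 + \<epsilon>) * M - (1 - \<epsilon>) * \<mu>) / ((1 + \<epsilon>) * M + (1 - \<epsilon>) * \<mu>))\<^sup>2"
  \<comment> \<open>Letting \<open>M\<close> decrease to \<open>L\<close> covers the case \<open>L = \<mu>\<close>, where interpolation degenerates.\<close>
  have M: "f (x (Suc i)) - f xmin \<le> ?\<rho> M * (f (x i) - f xmin)" if "L < M" for M
    using that quadratic_bounds_le[OF qb] assms d orth step min
    by (intro noisy_line_search_step[of f ?g]) (auto intro: quadratic_bounds_mono[OF qb])
  \<comment> \<open>A nonzero denominator at \<open>M = L\<close> makes the rate continuous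
    there.\<close>
  have pos: "(1 + \<epsilon>) * L + (1 - \<epsilon>) * \<mu> > 0" using assms by (intro add_pos_pos) auto
  have "((\<lambda>M. ?\<rho> M * (f (x i) - f xmin)) \<longlongrightarrow> ?\<rho> L * (f (x i) - f xmin)) (at_right L)"
    using pos by (intro tendsto_intros) auto
  then have "f (x (Suc i)) - f xmin \<le> ?\<rho> L * (f (x i) - f xmin)"
    by (rule tendsto_lowerbound) (auto intro!: eventually_at_rightI[of L "L + 1"] M)
  moreover have "(1 - \<kappa>) / (1 + \<kappa>) = ((1 + \<epsilon>) * L - (1 - \<epsilon>) * \<mu>) / ((1 + \<epsilon>) * L + (1 - \<epsilon>) * \<mu>)"
  proof -
    define a b where ab: "a = (1 + \<epsilon>) * L" "b = (1 - \<epsilon>) * \<mu>"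
    have "\<kappa> = b / a" using assms(9) by (simp add: ab mult_ac)
    moreover have "a > 0" using assms by (simp add: ab)
    then have "1 - b / a = (a - b) / a" "1 + b / a = (a + b) / a" by (simp_all add: field_simps)
    ultimately show ?thesis unfolding ab[symmetric] using \<open>a > 0\<close> by simp
  qed
  ultimately show "f (x (Suc i)) - fmin \<le> ((1 - \<kappa>) / (1 + \<kappa>))\<^sup>2 * (f (x i) - fmin)"
    by (simp add: assms(5))
qed

end
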